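(* For every real $x\ge 2$, put $L_1=\ln x$, $L_2=\ln\ln x$, $\sigma=1/L_1$, $\tau=L_2/L_1$ and $\zeta=1/(1+\sigma)$. Then the series (in $m$) below is convergent and $$ W(x) = L_1 - L_2 + \sum_{m\ge 1} \frac{\tau^m}{m!}\, \sum_{p=0}^{m-1} (-1)^{p+m-1} \zeta^{p+m}{ p+m-1 \brace p}_{\ge 2}. $$
   Context: For $x>0$, $W(x)$ denotes the unique positive real solution $y$ of $y e^y=x$ (the Lambert $W$ function). The 2-associated Stirling subset numbers ${n\brace m}_{\ge 2}$ are defined by $$(e^z-1-z)^m=m!\sum_n{n\brace m}_{\ge 2}\frac{z^n}{n!};$$ in particular ${0\brace 0}_{\ge 2}=1$ and ${n\brace 0}_{\ge 2}=0$ for $n\ge 1$. *)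

theory Defs
  imports "HOL-Analysis.Analysis" "HOL-Computational_Algebra.Formal_Power_Series"
begin

text \<open>The Lambert W function; meaningful only for \<open>x > 0\<close>, where
  \<open>lambert_W_unique\<close> below shows that the description is proper.\<close>

definition lambert_W :: "real \<Rightarrow> real" where
  "lambert_W x = (THE y. y > 0 \<and> y * exp y = x)"

lemma lambert_W_unique:
  fixes x :: real
  assumes "x > 0"
  shows "\<exists>!y. y > 0 \<and> y * exp y = x"
proof -
  have mono: "a * exp a < b * exp b" if "0 < a" "a < b" for a b :: real
    using that by (intro mult_strict_mono) auto
  have "\<exists>y\<ge>0. y \<le> x \<and> y * exp y = x"
    using assms by (intro IVT') (auto intro!: continuous_intros)
  then obtain y where y: "y \<ge> 0" "y * exp y = x" by blast
  with assms have "y > 0" by (cases "y = 0") auto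
  with y show ?thesis
    by (metis mono less_irrefl linorder_neqE_linordered_idom)
qed

text \<open>The 2-associated Stirling subset numbers, as real numbers, read off from
  \<open>(e\<^sup>z - 1 - z)\<^sup>m = m! \<Sum>\<^sub>n stirling2_assoc n m z\<^sup>n / n!\<close>.\<close>

definition stirling2_assoc :: "nat \<Rightarrow> nat \<Rightarrow> real" where
  "stirling2_assoc n m =
     fact n / fact m * fps_nth ((fps_exp 1 - 1 - fps_X) ^ m) n"

lemma stirling2_assoc_gf:
  "(fps_exp 1 - 1 - fps_X) ^ m =
     fps_const (fact m) * Abs_fps (\<lambda>n. stirling2_assoc n m / fact n)"
  by (rule fps_ext) (simp add: stirling2_assoc_def)

lemma stirling2_assoc_0_right: "stirling2_assoc n 0 = (if n = 0 then 1 else 0)"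
  by (simp add: stirling2_assoc_def)

end

theory Submission
  imports Defs
begin

text \<open>
  Write \<open>W(x) = L\<^sub>1 - L\<^sub>2 + u\<close>. Then \<open>W e\<^sup>W = x\<close> says that \<open>L\<^sub>1 - L\<^sub>2 + u = L\<^sub>1 e\<^sup>-\<^sup>u\<close>, and dividing
  by \<open>L\<^sub>1 + 1\<close> turns this into the fixed-point equation
  \<open>u = w + h(u)\<close> with \<open>w = \<zeta>\<tau>\<close> and \<open>h(u) = \<zeta> (e\<^sup>-\<^sup>u - 1 + u)\<close>. Since \<open>h\<close> vanishes to second order at
  \<open>0\<close>, the equation has a unique formal solution \<open>U\<close>, a power series in \<open>w\<close>, namely the compositional
  inverse of \<open>X - h\<close>. Lagrange inversion expresses the coefficients of \<open>U\<close> by those of the powers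
  \<open>h\<^sup>p\<close>, which are the 2-associated Stirling numbers up to signs and factorials; this gives exactly
  the series of the theorem (\<open>fps_inv_X_minus_nth\<close>, \<open>fps_nth_power_exp_tail\<close>).

  It remains to see that the formal solution converges at \<open>w\<close> to an actual solution. Convergence
  follows by Cauchy's method of majorants: replacing every coefficient of \<open>h\<close> by its absolute
  value gives \<open>\<zeta> (e\<^sup>r - 1 - r)\<close>, and if \<open>R + \<zeta> (e\<^sup>r - 1 - r) \<le> r\<close>, then the partial sums of
  \<open>\<Sum> \<bar>U\<^sub>m\<bar> R\<^sup>m\<close> never exceed \<open>r\<close> (\<open>partial_norm_fixpoint_le\<close>). With \<open>r = ln 2\<close> this
  admits every \<open>\<bar>w\<bar> < ln 2 - \<zeta> (1 - ln 2)\<close>, which is true for all \<open>x \<ge> 2\<close> (\<open>abs_ln_less\<close>). That the sum \<open>u\<close> solves the equation is not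
  automatic, as it involves the exponential of a power series, but \<open>e\<^sup>-\<^sup>U\<close> is a linear
  combination of \<open>1\<close>, \<open>X\<close> and \<open>U\<close> by the formal equation, so it converges where \<open>U\<close> does, and a
  differential equation identifies its sum as \<open>e\<^sup>-\<^sup>u\<close> (\<open>eval_fps_exp_compose\<close>). The number
  \<open>L\<^sub>1 - L\<^sub>2 + u = L\<^sub>1 e\<^sup>-\<^sup>u\<close> is then positive and must be \<open>W(x)\<close>.
\<close>

unbundle no vec_syntax
unbundle fps_syntax

section \<open>Lagrange inversion\<close>

text \<open>
  With \<open>G = X\<psi>\<close>, differentiating \<open>X = \<Sum> U\<^sub>k G\<^sup>k\<close> gives \<open>1 = \<Sum> k U\<^sub>k G\<^sup>k\<^sup>-\<^sup>1 G'\<close>. Multiply by \<open>\<psi>\<^sup>-\<^sup>m\<close> and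
  compare coefficients of \<open>X\<^sup>m\<^sup>-\<^sup>1\<close>: up to a power of \<open>X\<close>, \<open>G\<^sup>k\<^sup>-\<^sup>1 G' \<psi>\<^sup>-\<^sup>m\<close> is \<open>G\<^sup>k\<^sup>-\<^sup>m\<^sup>-\<^sup>1 G'\<close>, whose residue
  is zero unless \<open>k = m\<close>, because it is a derivative otherwise. The proof phrases this
  residue without negative powers of \<open>X\<close>.
\<close>

lemma Lagrange_inversion:
  fixes U \<psi> :: "'a :: field_char_0 fps"
  assumes "\<psi> $ 0 \<noteq> 0" and "U oo (fps_X * \<psi>) = fps_X" and "m > 0"
  shows "of_nat m * U $ m = (inverse \<psi> ^ m) $ (m - 1)"
proof -
  define G where "G = fps_X * \<psi>"
  define D where "D = fps_deriv G"
  define I where "I = inverse \<psi>"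
  have I1: "I * \<psi> = 1"
    using assms(1) by (simp add: I_def inverse_mult_eq_1)
  have D: "D = \<psi> + fps_X * fps_deriv \<psi>"
    by (simp add: D_def G_def)
  have G0: "G $ 0 = 0" by (simp add: G_def)
  have "fps_deriv (U oo G) = 1"
    using assms(2) by (simp add: G_def)
  then have E: "(fps_deriv U oo G) * D = 1"
    using fps_compose_deriv[OF G0, of U] by (simp add: D_def)
  \<comment> \<open>In terms of Laurent series, this is the residue of \<open>G\<^sup>k\<^sup>-\<^sup>m G'\<close>.\<close>
  have residue: "(G ^ k * D * I ^ m) $ (m - 1) = (if k = m - 1 then 1 else 0)" if "k < m" for k
  proof -
    define j where "j = m - 1 - k"
    have m: "m = Suc (k + j)" using that by (simp add: j_def)
    have "G ^ k * D * I ^ m = fps_X ^ k * ((I * \<psi>) ^ k * (D * I ^ Suc j))"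
      by (simp add: G_def m power_mult_distrib power_add mult_ac)
    also have "\<dots> $ (m - 1) = (D * I ^ Suc j) $ j"
      by (simp only: I1 power_one mult_1 fps_X_power_mult_nth) (simp add: m)
    finally have *: "(G ^ k * D * I ^ m) $ (m - 1) = (D * I ^ Suc j) $ j" .
    have "(D * I ^ Suc j) $ j = (if j = 0 then 1 else 0)"
    proof (cases j)
      case 0
      have "D $ 0 * I $ 0 = (I * \<psi>) $ 0" by (simp add: D)
      then show ?thesis using 0 by (simp add: I1)
    next
      case (Suc l)
      \<comment> \<open>Now \<open>D I\<^sup>j\<^sup>+\<^sup>1 = I\<^sup>j - X (I\<^sup>j)' / j\<close>, and \<open>X d/dX\<close> multiplies the coefficient of \<open>X\<^sup>j\<close> by \<open>j\<close>.\<close>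
      have dI: "fps_deriv I = - (fps_deriv \<psi> * I\<^sup>2)"
        using fps_inverse_deriv[OF assms(1)] by (simp add: I_def)
      have "D * I ^ Suc j = (I * \<psi>) * I ^ j + fps_X * (fps_deriv \<psi> * I\<^sup>2) * I ^ (j - 1)"
        by (simp add: D Suc algebra_simps power2_eq_square)
      then have 1: "D * I ^ Suc j = I ^ j - fps_X * (fps_deriv I * I ^ (j - 1))"
        by (simp add: I1 dI mult_ac)
      have "fps_deriv (I ^ j) = of_nat j * (fps_deriv I * I ^ (j - 1))"
        by (simp add: fps_deriv_power fps_of_nat mult_ac)
      then have "of_nat j * (fps_deriv I * I ^ (j - 1)) $ l = of_nat j * (I ^ j) $ j"
        by (metis Suc fps_deriv_nth fps_mult_of_nat_nth(1) Suc_eq_plus1)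
      then have "(fps_deriv I * I ^ (j - 1)) $ l = (I ^ j) $ j"
        using Suc by (metis mult_left_cancel of_nat_neq_0)
      then show ?thesis
        unfolding 1 using Suc by simp
    qed
    then show ?thesis unfolding * using that by (auto simp: j_def)
  qed
  define P where "P = D * I ^ m"
  have "(I ^ m) $ (m - 1) = ((fps_deriv U oo G) * P) $ (m - 1)"
    unfolding P_def by (metis E mult.assoc mult_1)
  also have "\<dots> = (\<Sum>i=0..m - 1. (\<Sum>k=0..i. fps_deriv U $ k * (G ^ k) $ i) * P $ (m - 1 - i))"
    by (simp add: fps_mult_nth fps_compose_nth)
  also have "\<dots> = (\<Sum>i=0..m - 1. (\<Sum>k=0..m - 1. fps_deriv U $ k * (G ^ k) $ i) * P $ (m - 1 - i))"
    \<comment> \<open>\<open>G\<^sup>k\<close> starts at \<open>X\<^sup>k\<close>, so the inner range may be made independent of \<open>i\<close>.\<close>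
    by (intro sum.cong refl arg_cong2[where f = "(*)"] sum.mono_neutral_left)
       (auto simp: startsby_zero_power_prefix[OF G0])
  also have "\<dots> = (\<Sum>k=0..m - 1. fps_deriv U $ k * (G ^ k * P) $ (m - 1))"
    unfolding sum_distrib_right
    by (subst sum.swap) (simp add: fps_mult_nth[of _ P] sum_distrib_left mult.assoc)
  also have "\<dots> = (\<Sum>k=0..m - 1. fps_deriv U $ k * (if k = m - 1 then 1 else 0))"
    using residue assms(3) by (intro sum.cong) (auto simp: P_def mult.assoc[symmetric])
  also have "\<dots> = of_nat m * U $ m"
    using assms(3) by (simp add: if_distrib[of "(*) _"] cong: if_cong)
  finally show ?thesis by (simp add: I_def)
qed

text \<open>
  Lagrange inversion with \<open>\<psi> = 1 - K\<close>, \<open>K = H / X\<close>, combined with the binomial series of \<open>(1 - K)\<^sup>-\<^sup>m\<close>. That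
  series stops at \<open>p = m - 1\<close> in the coefficient of \<open>X\<^sup>m\<^sup>-\<^sup>1\<close> because \<open>K\<close> has no constant term.
\<close>
lemma fps_inv_X_minus_nth:
  fixes H :: "'a :: field_char_0 fps"
  assumes "H $ 0 = 0" and "H $ 1 = 0" and "m > 0"
  shows "fps_inv (fps_X - H) $ m =
           (\<Sum>p=0..m - 1. fact (p + m - 1) / (fact m * fact p) * (H ^ p) $ (p + m - 1))"
proof -
  define K where "K = fps_shift 1 H"
  have H: "H = fps_X * K"
    using assms(1) by (intro fps_ext) (auto simp: K_def)
  have K0: "K $ 0 = 0" using assms(2) by (simp add: K_def)
  let ?U = "fps_inv (fps_X - H)"
  have "?U oo (fps_X * (1 - K)) = fps_X"
    using fps_inv[of "fps_X - H"] assms(1,2) by (simp add: H algebra_simps)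
  then have "of_nat m * ?U $ m = (inverse (1 - K) ^ m) $ (m - 1)"
    using K0 assms(3) by (intro Lagrange_inversion) auto
  also have "inverse (1 - K) ^ m = fps_binomial (- of_nat m) oo (- K)"
  proof -
    have "fps_binomial (- of_nat m) oo (- K) = inverse ((1 + fps_X) ^ m oo (- K))"
      unfolding fps_binomial_minus_of_nat
      using K0 by (intro fps_inverse_compose) (auto simp: fps_power_zeroth_eq_one)
    also have "\<dots> = inverse ((1 - K) ^ m)"
      using K0 by (simp add: fps_compose_power[symmetric] fps_compose_add_distrib)
    finally show ?thesis by (simp add: fps_inverse_power)
  qed
  also have "\<dots> $ (m - 1) = (\<Sum>p=0..m - 1. of_nat m * (fact (p + m - 1) / (fact m * fact p) * (H ^ p) $ (p + m - 1)))"
    unfolding fps_compose_nth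
  proof (intro sum.cong refl)
    fix p
    have "((- K) ^ p) $ (m - 1) = (-1) ^ p * (K ^ p) $ (m - 1)"
      by (cases "even p") auto
    moreover have "(K ^ p) $ (m - 1) = (H ^ p) $ (p + m - 1)"
      using assms(3) by (simp add: H power_mult_distrib fps_X_power_mult_nth)
    moreover have "(- of_nat m gchoose p) = (-1) ^ p * (fact (p + m - 1) / (fact (m - 1) * fact p) :: 'a)"
    proof -
      have "(- of_nat m gchoose p) = (-1) ^ p * (of_nat (p + m - 1) gchoose p :: 'a)"
        using assms(3) by (subst gbinomial_negated_upper) (simp add: algebra_simps of_nat_diff)
      also have "of_nat (p + m - 1) gchoose p = fact (p + m - 1) / (fact (m - 1) * fact p)"
        using assms(3) unfolding binomial_gbinomial[symmetric] by (subst binomial_fact) auto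
      finally show ?thesis .
    qed
    moreover have "(fact m :: 'a) = of_nat m * fact (m - 1)"
      using assms(3) by (simp add: fact_reduce)
    ultimately show "fps_binomial (- of_nat m) $ p * ((- K) ^ p) $ (m - 1) =
        of_nat m * (fact (p + m - 1) / (fact m * fact p) * (H ^ p) $ (p + m - 1))"
      using assms(3) by (simp add: power_mult_distrib[symmetric] flip: mult.assoc)
  qed
  finally have "of_nat m * ?U $ m =
      of_nat m * (\<Sum>p=0..m - 1. fact (p + m - 1) / (fact m * fact p) * (H ^ p) $ (p + m - 1))"
    by (simp only: sum_distrib_left)
  then show ?thesis
    using assms(3) by (subst (asm) mult_left_cancel) auto
qed

section \<open>Convergence by majorants\<close>

definition partial_norm :: "real \<Rightarrow> nat \<Rightarrow> real fps \<Rightarrow> real" where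
  "partial_norm R N A = (\<Sum>m\<le>N. \<bar>A $ m\<bar> * R ^ m)"

lemma partial_norm_nonneg: "R \<ge> 0 \<Longrightarrow> partial_norm R N A \<ge> 0"
  by (simp add: partial_norm_def sum_nonneg)

text \<open>
  The Cauchy product sums over the triangle \<open>i + j \<le> N\<close>, the product of the norms over the
  square of side \<open>M\<close>. Besides \<open>M = N\<close>, the case \<open>N = M + 1\<close> for two factors without constant term is
  needed: then the corners of the triangle contribute nothing.
\<close>
lemma partial_norm_mult:
  assumes "R \<ge> 0"
    and supp: "\<And>i j. i + j \<le> N \<Longrightarrow> A $ i \<noteq> 0 \<Longrightarrow> B $ j \<noteq> 0 \<Longrightarrow> i \<le> M \<and> j \<le> M"
  shows "partial_norm R N (A * B) \<le> partial_norm R M A * partial_norm R M B"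
proof -
  let ?f = "\<lambda>i j. \<bar>A $ i\<bar> * R ^ i * (\<bar>B $ j\<bar> * R ^ j)"
  have "partial_norm R N (A * B) \<le> (\<Sum>m\<le>N. \<Sum>i\<le>m. ?f i (m - i))"
    unfolding partial_norm_def
  proof (rule sum_mono)
    fix m
    have "\<bar>(A * B) $ m\<bar> * R ^ m \<le> (\<Sum>i\<le>m. \<bar>A $ i\<bar> * \<bar>B $ (m - i)\<bar>) * R ^ m"
      unfolding fps_mult_nth atLeast0AtMost using assms(1)
      by (intro mult_right_mono order_trans[OF sum_abs]) (simp_all add: abs_mult)
    also have "\<dots> = (\<Sum>i\<le>m. ?f i (m - i))"
      unfolding sum_distrib_right
      by (intro sum.cong refl) (simp add: mult_ac flip: power_add)
    finally show "\<bar>(A * B) $ m\<bar> * R ^ m \<le> (\<Sum>i\<le>m. ?f i (m - i))" .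
  qed
  also have "\<dots> = (\<Sum>(i, j)\<in>{(i, j). i + j \<le> N}. ?f i j)"
    by (rule sum.triangle_reindex_eq[symmetric])
  also have "\<dots> = (\<Sum>(i, j)\<in>{(i, j). i + j \<le> N} \<inter> {..M} \<times> {..M}. ?f i j)"
  proof (rule sum.mono_neutral_right)
    show "finite {(i, j). i + j \<le> N}"
      by (rule finite_subset[of _ "{..N} \<times> {..N}"]) auto
  qed (use supp in force)+
  also have "\<dots> \<le> (\<Sum>(i, j)\<in>{..M} \<times> {..M}. ?f i j)"
    using assms(1) by (intro sum_mono2) auto
  also have "\<dots> = partial_norm R M A * partial_norm R M B"
    by (simp add: partial_norm_def sum_product sum.cartesian_product)
  finally show ?thesis .
qed

lemma partial_norm_power:
  assumes "R \<ge> 0"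
  shows "partial_norm R N (A ^ i) \<le> partial_norm R N A ^ i"
proof (induction i)
  case 0
  have "partial_norm R N 1 = (\<Sum>m\<in>{0}. \<bar>(1 :: real fps) $ m\<bar> * R ^ m)"
    unfolding partial_norm_def by (rule sum.mono_neutral_right) auto
  then show ?case by simp
next
  case (Suc i)
  have "partial_norm R N (A ^ Suc i) \<le> partial_norm R N A * partial_norm R N (A ^ i)"
    unfolding power_Suc using assms by (rule partial_norm_mult) auto
  also have "\<dots> \<le> partial_norm R N A * partial_norm R N A ^ i"
    using assms by (intro mult_left_mono Suc.IH partial_norm_nonneg)
  finally show ?case by simp
qed

text \<open>
  The gain of one order is what drives the induction in \<open>partial_norm_fixpoint_le\<close>: the
  coefficients of \<open>A\<^sup>i\<close> up to order \<open>N + 1\<close> involve only those of \<open>A\<close> up to order \<open>N\<close>.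
\<close>
lemma partial_norm_power_Suc:
  assumes "R \<ge> 0" and "A $ 0 = 0" and "i \<ge> 2"
  shows "partial_norm R (Suc N) (A ^ i) \<le> partial_norm R N A ^ i"
proof -
  obtain k where i: "i = Suc (Suc k)"
    using assms(3) by (metis add_2_eq_Suc le_Suc_ex)
  have "partial_norm R (Suc N) (A ^ i) \<le> partial_norm R N A * partial_norm R N (A ^ Suc k)"
    unfolding i power_Suc[of A "Suc k"]
  proof (rule partial_norm_mult[OF assms(1)])
    fix a b assume "a + b \<le> Suc N" "A $ a \<noteq> 0" "(A ^ Suc k) $ b \<noteq> 0"
    moreover from this have "a \<noteq> 0"
      using assms(2) by (intro notI) simp
    moreover have "b \<noteq> 0"
      using \<open>(A ^ Suc k) $ b \<noteq> 0\<close> assms(2) by (intro notI) simp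
    ultimately show "a \<le> N \<and> b \<le> N" by linarith
  qed
  also have "\<dots> \<le> partial_norm R N A * partial_norm R N A ^ Suc k"
    using assms(1) by (intro mult_left_mono partial_norm_power partial_norm_nonneg)
  finally show ?thesis by (simp add: i)
qed

text \<open>
  Induction on \<open>N\<close>: as \<open>H\<close> starts at order two, the norm of \<open>X + H(U)\<close> up to order \<open>N + 1\<close> is at
  most \<open>R + \<Sum> \<bar>H\<^sub>i\<bar> \<rho>\<^sup>i\<close>, where \<open>\<rho> \<le> r\<close> is the norm of \<open>U\<close> up to order \<open>N\<close>. The hypothesis \<open>bound\<close>
  says that this majorant maps \<open>[0, r]\<close> into itself.
\<close>
lemma partial_norm_fixpoint_le:
  fixes U H :: "real fps"
  assumes fixpoint: "U = fps_X + (H oo U)"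
    and "U $ 0 = 0" and "H $ 0 = 0" and "H $ 1 = 0" and "R \<ge> 0" and "r \<ge> 0"
    and bound: "\<And>N. R + (\<Sum>i\<le>N. \<bar>H $ i\<bar> * r ^ i) \<le> r"
  shows "partial_norm R N U \<le> r"
proof (induction N)
  case 0
  then show ?case using assms by (simp add: partial_norm_def)
next
  case (Suc N)
  have "\<bar>U $ m\<bar> \<le> (if m = 1 then 1 else 0) + (\<Sum>i\<le>Suc N. \<bar>H $ i\<bar> * \<bar>(U ^ i) $ m\<bar>)"
    if "m \<le> Suc N" for m
  proof -
    have "U $ m = (if m = 1 then 1 else 0) + (\<Sum>i=0..m. H $ i * (U ^ i) $ m)"
      by (subst fixpoint) (simp add: fps_compose_nth)
    then have "\<bar>U $ m\<bar> \<le> (if m = 1 then 1 else 0) + \<bar>\<Sum>i=0..m. H $ i * (U ^ i) $ m\<bar>"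
      by (auto split: if_splits)
    also have "\<bar>\<Sum>i=0..m. H $ i * (U ^ i) $ m\<bar> \<le> (\<Sum>i=0..m. \<bar>H $ i\<bar> * \<bar>(U ^ i) $ m\<bar>)"
      by (rule order_trans[OF sum_abs]) (simp add: abs_mult)
    also have "\<dots> \<le> (\<Sum>i\<le>Suc N. \<bar>H $ i\<bar> * \<bar>(U ^ i) $ m\<bar>)"
      using that by (intro sum_mono2) auto
    finally show ?thesis by simp
  qed
  then have "partial_norm R (Suc N) U \<le>
      (\<Sum>m\<le>Suc N. ((if m = 1 then 1 else 0) + (\<Sum>i\<le>Suc N. \<bar>H $ i\<bar> * \<bar>(U ^ i) $ m\<bar>)) * R ^ m)"
    unfolding partial_norm_def using assms(5) by (intro sum_mono mult_right_mono) auto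
  also have "\<dots> = (\<Sum>m\<le>Suc N. if m = 1 then R else 0) +
      (\<Sum>m\<le>Suc N. \<Sum>i\<le>Suc N. \<bar>H $ i\<bar> * (\<bar>(U ^ i) $ m\<bar> * R ^ m))"
    unfolding sum.distrib[symmetric] ring_distribs sum_distrib_right
    by (intro sum.cong refl arg_cong2[where f = "(+)"]) (auto simp: mult_ac)
  also have "(\<Sum>m\<le>Suc N. \<Sum>i\<le>Suc N. \<bar>H $ i\<bar> * (\<bar>(U ^ i) $ m\<bar> * R ^ m)) =
      (\<Sum>i\<le>Suc N. \<bar>H $ i\<bar> * partial_norm R (Suc N) (U ^ i))"
    unfolding partial_norm_def sum_distrib_left by (rule sum.swap)
  also have "\<dots> \<le> (\<Sum>i\<le>Suc N. \<bar>H $ i\<bar> * r ^ i)"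
  proof (rule sum_mono)
    fix i
    show "\<bar>H $ i\<bar> * partial_norm R (Suc N) (U ^ i) \<le> \<bar>H $ i\<bar> * r ^ i"
    proof (cases "i \<ge> 2")
      case True
      have "partial_norm R (Suc N) (U ^ i) \<le> partial_norm R N U ^ i"
        using assms True by (intro partial_norm_power_Suc) auto
      also have "\<dots> \<le> r ^ i"
        using Suc.IH assms(5) by (intro power_mono partial_norm_nonneg)
      finally show ?thesis by (intro mult_left_mono) auto
    next
      case False
      then have "i = 0 \<or> i = 1" by auto
      then show ?thesis using assms(3,4) by auto
    qed
  qed
  also have "(\<Sum>m\<le>Suc N. if m = 1 then R else 0) = R"
    by (subst sum.delta) auto
  finally show ?case using bound[of "Suc N"] by linarith
qed

lemma fps_conv_radius_fixpoint_ge: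
  fixes U H :: "real fps"
  assumes "U = fps_X + (H oo U)"
    and "U $ 0 = 0" and "H $ 0 = 0" and "H $ 1 = 0" and "R \<ge> 0" and "r \<ge> 0"
    and "\<And>N. R + (\<Sum>i\<le>N. \<bar>H $ i\<bar> * r ^ i) \<le> r"
  shows "fps_conv_radius U \<ge> R"
proof -
  have "summable (\<lambda>m. \<bar>U $ m\<bar> * R ^ m)"
  proof (rule bounded_imp_summable)
    fix N
    show "(\<Sum>m\<le>N. \<bar>U $ m\<bar> * R ^ m) \<le> r"
      using partial_norm_fixpoint_le[OF assms, of N] by (simp add: partial_norm_def)
  qed (use assms(5) in auto)
  then have "summable (\<lambda>m. U $ m * R ^ m)"
    using assms(5) by (intro summable_norm_cancel[of "\<lambda>m. U $ m * R ^ m"]) (simp add: abs_mult)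
  then show ?thesis
    using conv_radius_geI[of "fps_nth U" R] assms(5) by (simp add: fps_conv_radius_def)
qed

section \<open>The exponential of a convergent power series\<close>

text \<open>
  The formal identity \<open>E' = c E U'\<close> for \<open>E = e\<^sup>c\<^sup>U\<close> also holds for the sums, so \<open>E(t) e\<^sup>-\<^sup>c\<^sup>U\<^sup>(\<^sup>t\<^sup>)\<close> is
  constant. This way no double series needs to be rearranged; the price is that convergence of \<open>E\<close>
  is a hypothesis.
\<close>
lemma eval_fps_exp_compose:
  fixes U :: "'a :: {banach, real_normed_field} fps"
  assumes "U $ 0 = 0" and z: "norm z < fps_conv_radius U"
    and z': "norm z < fps_conv_radius (fps_exp c oo U)"
  shows "eval_fps (fps_exp c oo U) z = exp (c * eval_fps U z)"
proof -
  define E where "E = fps_exp c oo U"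
  define S where "S = cball (0 :: 'a) (norm z)"
  have dE: "fps_deriv E = fps_const c * E * fps_deriv U"
    using assms(1) by (simp add: E_def fps_compose_deriv fps_compose_mult_distrib)
  have "\<exists>k. \<forall>t\<in>S. eval_fps E t * exp (- c * eval_fps U t) = k"
  proof (rule has_field_derivative_zero_constant)
    fix t assume t: "t \<in> S"
    have "norm t \<le> norm z" using t by (simp add: S_def)
    then have tU: "norm t < fps_conv_radius U" and tE: "norm t < fps_conv_radius E"
      using z z' unfolding E_def by (metis ereal_less_eq(3) le_less_trans)+
    have tdU: "norm t < fps_conv_radius (fps_deriv U)"
      using tU fps_conv_radius_deriv[of U] by (simp add: less_le_trans)
    have tcE: "norm t < fps_conv_radius (fps_const c * E)"
      using tE fps_conv_radius_mult[of "fps_const c" E] by (simp add: less_le_trans)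
    have "eval_fps (fps_deriv E) t = c * eval_fps E t * eval_fps (fps_deriv U) t"
      unfolding dE using tE tdU tcE by (simp add: eval_fps_mult)
    then show "((\<lambda>t. eval_fps E t * exp (- c * eval_fps U t)) has_field_derivative 0) (at t within S)"
      using tU tE by (auto intro!: derivative_eq_intros has_field_derivative_eval_fps simp: algebra_simps)
  qed (simp add: S_def)
  then obtain k where k: "\<And>t. t \<in> S \<Longrightarrow> eval_fps E t * exp (- c * eval_fps U t) = k" by blast
  have "k = 1"
    using k[of 0] assms(1) by (simp add: S_def eval_fps_at_0 E_def)
  then show ?thesis
    using k[of z] by (simp add: S_def E_def exp_minus field_simps)
qed

section \<open>The fixed-point equation of the Lambert function\<close>

definition exp_tail :: "real \<Rightarrow> real fps" where
  "exp_tail \<zeta> = fps_const \<zeta> * (fps_exp (- 1) - 1 + fps_X)"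

lemma exp_tail_nth_0 [simp]: "exp_tail \<zeta> $ 0 = 0"
  and exp_tail_nth_1: "exp_tail \<zeta> $ 1 = 0"
  by (simp_all add: exp_tail_def)

lemma fps_nth_power_exp_tail:
  "(exp_tail \<zeta> ^ p) $ n = \<zeta> ^ p * ((- 1) ^ n * fact p / fact n * stirling2_assoc n p)"
proof -
  have "(fps_exp (- 1) - 1 + fps_X :: real fps) ^ p = (fps_exp 1 - 1 - fps_X) ^ p oo (- fps_X)"
    by (simp add: fps_compose_power[symmetric] fps_compose_sub_distrib)
  then show ?thesis
    by (simp add: exp_tail_def power_mult_distrib fps_const_power
        fps_compose_uminus' stirling2_assoc_def)
qed

lemma exp_tail_majorant:
  assumes "\<zeta> \<ge> 0" and "r \<ge> 0"
  shows "(\<Sum>i\<le>N. \<bar>exp_tail \<zeta> $ i\<bar> * r ^ i) \<le> \<zeta> * (exp r - 1 - r)"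
proof -
  have "(\<lambda>i. \<zeta> * ((r ^ i /\<^sub>R fact i) - (if i = 0 then 1 else 0) - (if i = 1 then r else 0)))
          sums (\<zeta> * (exp r - 1 - r))"
    using sums_single[of 0 "\<lambda>_. 1 :: real"] sums_single[of 1 "\<lambda>_. r"]
    by (intro sums_mult sums_diff exp_converges) auto
  also have "(\<lambda>i. \<zeta> * ((r ^ i /\<^sub>R fact i) - (if i = 0 then 1 else 0) - (if i = 1 then r else 0))) =
      (\<lambda>i. \<bar>exp_tail \<zeta> $ i\<bar> * r ^ i)"
  proof
    fix i
    show "\<zeta> * ((r ^ i /\<^sub>R fact i) - (if i = 0 then 1 else 0) - (if i = 1 then r else 0)) =
        \<bar>exp_tail \<zeta> $ i\<bar> * r ^ i"
      using assms(1) by (cases "i = 0 \<or> i = 1")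
        (auto simp: exp_tail_def abs_mult power_abs field_simps)
  qed
  finally have sums: "(\<lambda>i. \<bar>exp_tail \<zeta> $ i\<bar> * r ^ i) sums (\<zeta> * (exp r - 1 - r))" .
  then have "(\<Sum>i\<le>N. \<bar>exp_tail \<zeta> $ i\<bar> * r ^ i) \<le> (\<Sum>i. \<bar>exp_tail \<zeta> $ i\<bar> * r ^ i)"
    using assms(2) by (intro sum_le_suminf) (auto simp: sums_iff)
  with sums show ?thesis by (simp add: sums_iff)
qed

lemma fps_inv_exp_tail_solves:
  assumes "\<zeta> > 0" and "r \<ge> 0" and w: "\<bar>w\<bar> < r - \<zeta> * (exp r - 1 - r)"
  defines "U \<equiv> fps_inv (fps_X - exp_tail \<zeta>)"
  defines "u \<equiv> eval_fps U w"
  shows "norm w < fps_conv_radius U" and "u = w + \<zeta> * (exp (- u) - 1 + u)"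
proof -
  define R where "R = r - \<zeta> * (exp r - 1 - r)"
  define E where "E = fps_exp (- 1) oo U"
  have U0: "U $ 0 = 0" by (simp add: U_def fps_inv_def)
  have "(fps_X - exp_tail \<zeta>) oo U = fps_X"
    unfolding U_def by (intro fps_inv_right) (auto simp: exp_tail_nth_1[simplified])
  then have U: "U = fps_X + (exp_tail \<zeta> oo U)"
    using U0 by (simp add: fps_compose_sub_distrib algebra_simps)

  have "R \<ge> 0" using w by (simp add: R_def)
  moreover have "R + (\<Sum>i\<le>N. \<bar>exp_tail \<zeta> $ i\<bar> * r ^ i) \<le> r" for N
    using exp_tail_majorant[of \<zeta> r N] assms(1,2) by (simp add: R_def)
  ultimately have "fps_conv_radius U \<ge> R"
    using U U0 assms(2) exp_tail_nth_1
    by (intro fps_conv_radius_fixpoint_ge[where r = r and H = "exp_tail \<zeta>"]) auto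
  moreover have "ereal \<bar>w\<bar> < ereal R" using w by (simp add: R_def)
  ultimately show wU: "norm w < fps_conv_radius U"
    by (metis less_le_trans real_norm_def)

  \<comment> \<open>The formal equation, solved for the exponential: this is why \<open>E\<close> converges where \<open>U\<close> does.\<close>
  have E: "E = fps_const (1 / \<zeta>) * (U - fps_X) + (1 - U)"
  proof -
    have "exp_tail \<zeta> oo U = fps_const \<zeta> * (E - 1 + U)"
      using U0 by (simp add: exp_tail_def E_def fps_compose_mult_distrib
          fps_compose_add_distrib fps_compose_sub_distrib)
    then have "U - fps_X = fps_const \<zeta> * (E - 1 + U)"
      using U by (metis add_diff_cancel_left')
    then have "fps_const (1 / \<zeta>) * (U - fps_X) = E - 1 + U"
      using assms(1) by (simp flip: mult.assoc)
    then show ?thesis by simp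
  qed
  have w1: "norm w < fps_conv_radius (U - fps_X)"
    using wU fps_conv_radius_diff[of U fps_X] by (simp add: less_le_trans)
  have w2: "norm w < fps_conv_radius (fps_const (1 / \<zeta>) * (U - fps_X))"
    using w1 fps_conv_radius_mult[of "fps_const (1 / \<zeta>)" "U - fps_X"] by (simp add: less_le_trans)
  have w3: "norm w < fps_conv_radius (1 - U)"
    using wU fps_conv_radius_diff[of 1 U] by (simp add: less_le_trans)
  have wE: "norm w < fps_conv_radius E"
    unfolding E using w2 w3 by (intro less_le_trans[OF _ fps_conv_radius_add]) simp
  have "eval_fps E w = (1 / \<zeta>) * (u - w) + (1 - u)"
    unfolding E using wU w1 w2 w3
    by (simp add: eval_fps_mult eval_fps_add eval_fps_diff u_def)
  moreover have "eval_fps E w = exp (- u)"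
    using eval_fps_exp_compose[of U w "-1"] U0 wU wE by (simp add: E_def u_def)
  ultimately show "u = w + \<zeta> * (exp (- u) - 1 + u)"
    using assms(1) by (simp add: field_simps)
qed

lemma lambert_W_eqI:
  assumes "x > 1" and "ln x - ln (ln x) + u = ln x * exp (- u)"
  shows "lambert_W x = ln x - ln (ln x) + u"
  unfolding lambert_W_def
proof (rule the1_equality[OF lambert_W_unique])
  let ?y = "ln x - ln (ln x) + u"
  have L: "ln x > 0" using assms(1) by simp
  have "?y * exp ?y = ln x * exp (- u) * exp ?y"
    by (simp only: assms(2))
  also have "\<dots> = ln x * (exp (ln x) / exp (ln (ln x)))"
    by (simp add: exp_diff exp_add exp_minus field_simps)
  also have "\<dots> = x"
    using assms(1) L by simp
  finally show "0 < ?y \<and> ?y * exp ?y = x"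
    using assms(2) L by simp
qed (use assms(1) in auto)

text \<open>
  For \<open>t = ln x\<close> this is \<open>\<bar>w\<bar> < ln 2 - \<zeta> (1 - ln 2)\<close>, multiplied by \<open>t + 1\<close>. The
  bound \<open>2 / 3 \<le> ln 2\<close> leaves enough room to replace \<open>ln t\<close> by its tangent at \<open>4\<close> and
  \<open>- ln t\<close> by \<open>1 / t - 1 \<le> 1 / 2\<close>.
\<close>
lemma abs_ln_less:
  fixes t :: real
  assumes "t \<ge> ln 2"
  shows "\<bar>ln t\<bar> < (2 * ln 2 - 1) * t + ln 2"
proof -
  have two: "2 / 3 \<le> ln (2 :: real)" "ln (2 :: real) < 1"
    using ln2_ge_two_thirds ln_2_less_1 by auto
  have t: "t \<ge> 2 / 3" using assms two by linarith
  have lower: "1 / 3 * t \<le> (2 * ln 2 - 1) * t"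
    using two t by (intro mult_right_mono) auto
  have "ln 4 = 2 * ln (2 :: real)"
    using ln_realpow[of 2 2] by simp
  moreover have "ln (t / 4) \<le> t / 4 - 1"
    using t by (intro ln_le_minus_one) auto
  moreover have "ln (t / 4) = ln t - ln 4"
    using t by (simp add: ln_div)
  ultimately have "ln t < (2 * ln 2 - 1) * t + ln 2"
    using t two lower by linarith
  moreover have "- ln t < (2 * ln 2 - 1) * t + ln 2"
  proof -
    have "ln (1 / t) \<le> 1 / t - 1"
      using t by (intro ln_le_minus_one) auto
    moreover have "1 / t \<le> 3 / 2" using t by (simp add: field_simps)
    moreover have "ln (1 / t) = - ln t" using t by (simp add: ln_div)
    ultimately show ?thesis using t two lower by linarith
  qed
  ultimately show ?thesis by linarith
qed

theorem theorem3:
  fixes x L1 L2 \<sigma> \<tau> \<zeta> :: real and a :: "nat \<Rightarrow> real"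
  assumes "x \<ge> 2"
    and "L1 = ln x"
    and "L2 = ln (ln x)"
    and "\<sigma> = 1 / L1"
    and "\<tau> = L2 / L1"
    and "\<zeta> = 1 / (1 + \<sigma>)"
    and "\<And>m. a m = \<tau> ^ m / fact m *
           (\<Sum>p = 0..m - 1. (-1) ^ (p + m - 1) * \<zeta> ^ (p + m) * stirling2_assoc (p + m - 1) p)"
  shows "summable (\<lambda>k. a (Suc k)) \<and>
         lambert_W x = L1 - L2 + (\<Sum>k. a (Suc k))"
proof -
  have L1: "L1 \<ge> ln 2" and L1_pos: "L1 > 0"
    using assms(1,2) by auto
  have \<zeta>: "\<zeta> = L1 / (L1 + 1)"
    using L1_pos unfolding assms(6,4) by (simp add: field_simps)
  have \<zeta>_pos: "\<zeta> > 0" using L1_pos by (simp add: \<zeta>)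
  define w where "w = \<zeta> * \<tau>"
  have w: "w = L2 / (L1 + 1)"
    using L1_pos by (simp add: w_def \<zeta> assms(5))
  define U where "U = fps_inv (fps_X - exp_tail \<zeta>)"
  define u where "u = eval_fps U w"

  \<comment> \<open>The radius \<open>r - \<zeta> (e\<^sup>r - 1 - r)\<close> is largest at \<open>r = ln (1 + 1 / \<zeta>)\<close>; as \<open>\<zeta> < 1\<close> depends on \<open>x\<close>,
    the limiting value \<open>ln 2\<close> for \<open>\<zeta> = 1\<close> is used throughout.\<close>
  have "\<bar>w\<bar> < ln 2 - \<zeta> * (exp (ln 2) - 1 - ln 2)"
  proof -
    have "ln 2 - \<zeta> * (exp (ln 2) - 1 - ln 2) = ((2 * ln 2 - 1) * L1 + ln 2) / (L1 + 1)"
      using L1_pos by (simp add: \<zeta> field_simps)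
    then show ?thesis
      using abs_ln_less[OF L1] L1_pos assms(2,3)
      by (simp add: w abs_div divide_strict_right_mono)
  qed
  from fps_inv_exp_tail_solves[OF \<zeta>_pos _ this]
  have wU: "norm w < fps_conv_radius U" and fixpoint: "u = w + \<zeta> * (exp (- u) - 1 + u)"
    unfolding U_def u_def by simp_all

  have "(L1 + 1) * u = (L1 + 1) * (w + \<zeta> * (exp (- u) - 1 + u))"
    using fixpoint by simp
  also have "\<dots> = (L1 + 1) * w + ((L1 + 1) * \<zeta>) * (exp (- u) - 1 + u)"
    by (simp add: algebra_simps)
  also have "(L1 + 1) * w = L2"
    using L1_pos by (simp add: w)
  also have "(L1 + 1) * \<zeta> = L1"
    using L1_pos by (simp add: \<zeta>)
  finally have "L1 - L2 + u = L1 * exp (- u)"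
    by (simp add: algebra_simps)
  then have "lambert_W x = L1 - L2 + u"
    using assms(1-3) lambert_W_eqI[of x u] by simp
  moreover have coeff: "a (Suc k) = U $ Suc k * w ^ Suc k" for k
  proof -
    have "U $ Suc k = (\<Sum>p=0..k. (- 1) ^ (p + k) * \<zeta> ^ p * stirling2_assoc (p + k) p) / fact (Suc k)"
      unfolding U_def
      by (subst fps_inv_X_minus_nth)
         (auto simp: exp_tail_nth_1[simplified] fps_nth_power_exp_tail sum_divide_distrib intro!: sum.cong)
    then show ?thesis
      unfolding assms(7) w_def
      by (simp add: power_mult_distrib sum_distrib_left sum_divide_distrib power_add mult_ac)
  qed
  moreover have "summable (\<lambda>k. U $ Suc k * w ^ Suc k)"
    using summable_fps[OF wU] by (subst summable_Suc_iff)
  moreover have "u = (\<Sum>k. U $ Suc k * w ^ Suc k)"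
    using suminf_split_head[OF summable_fps[OF wU]]
    by (simp add: u_def eval_fps_def U_def fps_inv_def)
  ultimately show ?thesis by (simp only: coeff)
qed

end
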